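(* Let $\ell,m$ be integers with $1\le\ell<m$, and let $\mathbf{t}_{\ell,m}$ be the fixed point starting with $0$ of the morphism $0\mapsto0\ell m$, $\ell\mapsto\ell m0$, $m\mapsto m0\ell$ over the alphabet $\{0,\ell,m\}$. Then its abelian complexity is $\rho^{\mathrm{ab}}_{\mathbf{t}_{\ell,m}}=136(766)^\omega$, i.e., it takes values $1,3$ at $n=0,1$ and then, for $n\ge2$, equals $7$ if $n\equiv0\pmod3$ and $6$ otherwise. Its additive complexity satisfies $\rho^{\mathrm{add}}_{\mathbf{t}_{\ell,m}}=\rho^{\mathrm{ab}}_{\mathbf{t}_{\ell,m}}$ if $m\ne2\ell$, and $\rho^{\mathrm{add}}_{\mathbf{t}_{\ell,m}}=135^\omega$ (values $1,3$ at $n=0,1$ and $5$ for all $n\ge2$) if $m=2\ell$.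
   Context: Letters $0,\ell,m$ are regarded as integers. For a word $w$, $|w|_a$ counts occurrences of $a$. Words $u,v$ are abelian equivalent if $|u|_a=|v|_a$ for all letters $a$, and additively equivalent if $|u|=|v|$ and $\ell|u|_\ell+m|u|_m=\ell|v|_\ell+m|v|_m$. $\rho^{\mathrm{ab}}_{\mathbf{x}}(n)$ (resp. $\rho^{\mathrm{add}}_{\mathbf{x}}(n)$) is the number of abelian (resp. additive) equivalence classes of length-$n$ factors of $\mathbf{x}$. *)

theory Defs
  imports Main
begin

text \<open>Letters are integers, finite words are lists and infinite words are functions on
  \<^typ>\<open>nat\<close>. A morphism is given by its values on letters.\<close>

definition morph :: "('a \<Rightarrow> 'b list) \<Rightarrow> 'a list \<Rightarrow> 'b list" where
  "morph h w = concat (map h w)"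

definition factor_at :: "(nat \<Rightarrow> 'a) \<Rightarrow> nat \<Rightarrow> nat \<Rightarrow> 'a list" where
  "factor_at x i n = map x [i..<i + n]"

text \<open>The image of an infinite word under a non-erasing morphism: the images of the finite
  prefixes of \<open>x\<close> are prefixes of one another, and the image of the prefix of length
  \<open>n + 1\<close> has length at least \<open>n + 1\<close>, hence determines the letter at position \<open>n\<close>.\<close>

definition morph_inf :: "('a \<Rightarrow> 'b list) \<Rightarrow> (nat \<Rightarrow> 'a) \<Rightarrow> nat \<Rightarrow> 'b" where
  "morph_inf h x n = morph h (factor_at x 0 (Suc n)) ! n"

definition factors :: "(nat \<Rightarrow> 'a) \<Rightarrow> nat \<Rightarrow> 'a list set" where
  "factors x n = {factor_at x i n | i. True}"

definition abelian_equivalent :: "'a list \<Rightarrow> 'a list \<Rightarrow> bool" where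
  "abelian_equivalent u v \<longleftrightarrow> (\<forall>a. count_list u a = count_list v a)"

definition additively_equivalent :: "int \<Rightarrow> int \<Rightarrow> int list \<Rightarrow> int list \<Rightarrow> bool" where
  "additively_equivalent l m u v \<longleftrightarrow>
     length u = length v \<and>
     l * int (count_list u l) + m * int (count_list u m) =
     l * int (count_list v l) + m * int (count_list v m)"

definition abelian_complexity :: "(nat \<Rightarrow> 'a) \<Rightarrow> nat \<Rightarrow> nat" where
  "abelian_complexity x n =
     card (factors x n // {(u, v) \<in> factors x n \<times> factors x n. abelian_equivalent u v})"

definition additive_complexity :: "int \<Rightarrow> int \<Rightarrow> (nat \<Rightarrow> int) \<Rightarrow> nat \<Rightarrow> nat" where
  "additive_complexity l m x n =
     card (factors x n // {(u, v) \<in> factors x n \<times> factors x n. additively_equivalent l m u v})"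

text \<open>The last case is the letter \<open>m\<close>; values outside the alphabet \<open>{0, l, m}\<close> are irrelevant.\<close>

definition tm_morphism :: "int \<Rightarrow> int \<Rightarrow> int \<Rightarrow> int list" where
  "tm_morphism l m a =
     (if a = 0 then [0, l, m] else if a = l then [l, m, 0] else [m, 0, l])"

definition is_tm_word :: "int \<Rightarrow> int \<Rightarrow> (nat \<Rightarrow> int) \<Rightarrow> bool" where
  "is_tm_word l m x \<longleftrightarrow>
     range x \<subseteq> {0, l, m} \<and> x 0 = 0 \<and> morph_inf (tm_morphism l m) x = x"

definition tm_word :: "int \<Rightarrow> int \<Rightarrow> nat \<Rightarrow> int" where
  "tm_word l m = (THE x. is_tm_word l m x)"

lemma length_tm_morphism [simp]: "length (tm_morphism l m a) = 3"
  by (simp add: tm_morphism_def)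

lemma length_morph_tm_morphism [simp]: "length (morph (tm_morphism l m) w) = 3 * length w"
  by (induction w) (simp_all add: morph_def)

lemma nth_morph_tm_morphism:
  "n < 3 * length w \<Longrightarrow>
     morph (tm_morphism l m) w ! n = tm_morphism l m (w ! (n div 3)) ! (n mod 3)"
proof (induction w arbitrary: n)
  case Nil
  then show ?case by simp
next
  case (Cons a w)
  show ?case
  proof (cases "n < 3")
    case True
    then show ?thesis by (simp add: morph_def nth_append)
  next
    case False
    then obtain k where k: "n = k + 3" by (metis add.commute le_Suc_ex not_less)
    moreover have "(k + 3) div 3 = Suc (k div 3)" by simp
    ultimately show ?thesis using Cons by (simp add: morph_def nth_append del: One_nat_def)
  qed
qed

lemma morph_inf_tm_morphism:
  "morph_inf (tm_morphism l m) x n = tm_morphism l m (x (n div 3)) ! (n mod 3)"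
proof -
  have "n div 3 < Suc n" by (simp add: le_imp_less_Suc)
  then have "map x [0..<Suc n] ! (n div 3) = x (n div 3)"
    by (subst nth_map) (simp_all del: upt_Suc)
  then show ?thesis
    by (simp add: morph_inf_def factor_at_def nth_morph_tm_morphism del: upt_Suc)
qed

fun tm_letter :: "int \<Rightarrow> int \<Rightarrow> nat \<Rightarrow> int" where
  "tm_letter l m n =
     (if n = 0 then 0 else tm_morphism l m (tm_letter l m (n div 3)) ! (n mod 3))"

declare tm_letter.simps [simp del]

lemma tm_morphism_nth_in: "i < 3 \<Longrightarrow> tm_morphism l m a ! i \<in> {0, l, m}"
  by (auto simp: tm_morphism_def nth_Cons split: nat.splits)

lemma is_tm_word_tm_letter: "is_tm_word l m (tm_letter l m)"
  unfolding is_tm_word_def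
proof (intro conjI ext subsetI)
  fix a assume "a \<in> range (tm_letter l m)"
  then obtain n where "a = tm_letter l m n" by blast
  then show "a \<in> {0, l, m}"
    using tm_morphism_nth_in[of "n mod 3" l m] by (subst (asm) tm_letter.simps) (auto split: if_splits)
next
  show "tm_letter l m 0 = 0" by (simp add: tm_letter.simps)
next
  fix n
  show "morph_inf (tm_morphism l m) (tm_letter l m) n = tm_letter l m n"
    by (cases "n = 0")
       (simp_all add: morph_inf_tm_morphism tm_letter.simps[of l m n] tm_letter.simps[of l m 0]
         tm_morphism_def[of l m 0])
qed

lemma is_tm_word_unique:
  assumes "is_tm_word l m x"
  shows "x = tm_letter l m"
proof
  fix n
  show "x n = tm_letter l m n"
  proof (induction n rule: less_induct)
    case (less n)
    show ?case
    proof (cases "n = 0")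
      case True
      then show ?thesis using assms by (simp add: is_tm_word_def tm_letter.simps)
    next
      case False
      have "x n = tm_morphism l m (x (n div 3)) ! (n mod 3)"
        using assms morph_inf_tm_morphism[of l m x n] by (simp add: is_tm_word_def)
      with False less[of "n div 3"] show ?thesis by (simp add: tm_letter.simps[of l m n])
    qed
  qed
qed

lemma ex1_is_tm_word: "\<exists>!x. is_tm_word l m x"
  using is_tm_word_tm_letter is_tm_word_unique by blast

lemma is_tm_word_tm_word: "is_tm_word l m (tm_word l m)"
  unfolding tm_word_def by (rule theI'[OF ex1_is_tm_word])

lemma tm_word_eq_tm_letter: "tm_word l m = tm_letter l m"
  by (rule is_tm_word_unique) (rule is_tm_word_tm_word)

end

theory Submission
  imports Defs "HOL-Library.Product_Plus"
begin

text \<open>Every image of a letter contains each letter exactly once. Hence, up to a constant vector, the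
  Parikh vector of a factor depends only on the short pieces of the two images in which it begins
  and ends, that is, on a pair of letters of the word at some distance \<open>k\<close>. All nine
  pairs of letters occur at every distance \<open>k \<ge> 1\<close>, so the sets of Parikh
  vectors can be written down explicitly. The occurrence of all pairs is inherited from distance
  \<open>k div 3\<close> (or \<open>1\<close>, if \<open>k = 2\<close>) by passing to the images
  of the two letters; for \<open>k = 1\<close> the pairs inside an image produce the remaining ones
  at the boundaries of consecutive images.\<close>

section \<open>Counting classes, and cutting up factors\<close>

text \<open>The classes are the nonempty fibres of \<open>f\<close>, so sending a value to its fibre
  is a bijection. Both complexities thereby become cardinalities of images.\<close>

lemma card_quotient_kernel:
  "card (A // {(u, v) \<in> A \<times> A. f u = f v}) = card (f ` A)"
proof -
  let ?r = "{(u, v) \<in> A \<times> A. f u = f v}"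
  have "bij_betw (\<lambda>y. {v \<in> A. f v = y}) (f ` A) (A // ?r)"
    unfolding bij_betw_def
  proof
    show "inj_on (\<lambda>y. {v \<in> A. f v = y}) (f ` A)"
      by (rule inj_onI) blast
    have "A // ?r = (\<lambda>u. ?r `` {u}) ` A"
      by (auto simp: quotient_def)
    also have "\<dots> = (\<lambda>u. {v \<in> A. f v = f u}) ` A"
      by (rule image_cong) auto
    finally show "(\<lambda>y. {v \<in> A. f v = y}) ` f ` A = A // ?r"
      by (simp add: image_image)
  qed
  from bij_betw_same_card[OF this] show ?thesis by (rule sym)
qed

lemma factor_at_add: "factor_at x i (n + p) = factor_at x i n @ factor_at x (i + n) p"
  using upt_add_eq_append[of i "i + n" p] by (simp add: factor_at_def add.assoc)

lemma length_factor_at [simp]: "length (factor_at x i n) = n"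
  by (simp add: factor_at_def)

lemma factor_at_0 [simp]: "factor_at x i 0 = []"
  by (simp add: factor_at_def)

lemma factor_at_1: "factor_at x i (Suc 0) = [x i]"
  by (simp add: factor_at_def)

lemma factor_at_2: "factor_at x i 2 = [x i, x (Suc i)]"
  by (simp add: factor_at_def numeral_2_eq_2)

lemma set_factor_at_subset: "set (factor_at x i n) \<subseteq> range x"
  by (auto simp: factor_at_def)

lemma image_case_prod_Times: "(\<lambda>(a, b). f a b) ` (A \<times> B) = (\<Union>a\<in>A. f a ` B)"
  by auto

text \<open>The residue of the starting position fixes how much of its first image a factor can
  contain.\<close>

lemma factors_mod_3:
  "factors x n = range (\<lambda>q. factor_at x (3 * q) n) \<union> range (\<lambda>q. factor_at x (3 * q + 1) n)
     \<union> range (\<lambda>q. factor_at x (3 * q + 2) n)" (is "_ = ?R")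
proof
  show "factors x n \<subseteq> ?R"
  proof
    fix u assume "u \<in> factors x n"
    then obtain i where i: "u = factor_at x i n" by (auto simp: factors_def)
    have "i = 3 * (i div 3) \<or> i = 3 * (i div 3) + 1 \<or> i = 3 * (i div 3) + 2" by presburger
    with i show "u \<in> ?R" by (metis (no_types, lifting) UnI1 UnI2 rangeI)
  qed
qed (auto simp: factors_def)

section \<open>The word as a sequence of rotated blocks\<close>

locale tm_alphabet =
  fixes l m :: int
  assumes l_pos: "0 < l" and l_less_m: "l < m"
begin

abbreviation L :: "int set" where
  "L \<equiv> {0, l, m}"

abbreviation x :: "nat \<Rightarrow> int" where
  "x \<equiv> tm_word l m"

text \<open>Cyclic rotation of the alphabet: the image of \<open>a\<close> is \<open>a\<close>
  followed by its two successors. Applied twice, it gives the predecessor.\<close>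

definition next_letter :: "int \<Rightarrow> int" where
  "next_letter a = (if a = 0 then l else if a = l then m else 0)"

definition parikh :: "int list \<Rightarrow> int \<times> int \<times> int" where
  "parikh u = (int (count_list u 0), int (count_list u l), int (count_list u m))"

text \<open>The additive invariant: for words over \<open>L\<close>,
  \<open>weight (parikh u)\<close> is the sum of the letters of \<open>u\<close>.\<close>

definition weight :: "int \<times> int \<times> int \<Rightarrow> int" where
  "weight = (\<lambda>(_, b, c). l * b + m * c)"

lemma letters_distinct [simp]:
  "l \<noteq> 0" "m \<noteq> 0" "l \<noteq> m" "0 \<noteq> l" "0 \<noteq> m" "m \<noteq> l"
  using l_pos l_less_m by auto

lemma next_letter_simps [simp]: "next_letter 0 = l" "next_letter l = m" "next_letter m = 0"
  by (simp_all add: next_letter_def)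

lemma x_in_L: "x n \<in> L"
  using is_tm_word_tm_word[of l m] by (auto simp: is_tm_word_def)

lemma x_rec: "x n = tm_morphism l m (x (n div 3)) ! (n mod 3)"
  using is_tm_word_tm_word[of l m] morph_inf_tm_morphism[of l m x n] by (simp add: is_tm_word_def)

lemma x_0: "x 0 = 0"
  using is_tm_word_tm_word[of l m] by (simp add: is_tm_word_def)

lemma x_triple:
  "x (3 * q) = x q"
  "x (3 * q + 1) = next_letter (x q)"
  "x (3 * q + 2) = next_letter (next_letter (x q))"
proof -
  have "(3 * q + 1) div 3 = q" "(3 * q + 1) mod 3 = 1" "(3 * q + 2) div 3 = q"
    "(3 * q + 2) mod 3 = 2" by presburger+
  then show "x (3 * q) = x q" "x (3 * q + 1) = next_letter (x q)"
    "x (3 * q + 2) = next_letter (next_letter (x q))"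
    using x_in_L[of q]
    by (auto simp: x_rec[of "3 * q"] x_rec[of "3 * q + 1"] x_rec[of "3 * q + 2"] tm_morphism_def
        simp del: One_nat_def add_2_eq_Suc')
qed

section \<open>Pairs of letters at a given distance\<close>

lemma letter_occurs:
  assumes "a \<in> L"
  obtains q where "x q = a"
  using assms x_0 x_triple(2,3)[of 0] by auto

text \<open>Inside images, each letter is followed by its successor. Where two images meet, the
  second letter of the original pair is kept and the first is replaced by its predecessor; two
  rounds of this reach all cyclic differences.\<close>

lemma pairs_at_distance_1:
  assumes "a \<in> L" "b \<in> L"
  shows "\<exists>q. x q = a \<and> x (q + 1) = b"
proof -
  have step: "\<exists>q. x q = next_letter (next_letter a) \<and> x (q + 1) = b"
    if "\<exists>q. x q = a \<and> x (q + 1) = b" for a b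
  proof -
    from that obtain q where q: "x q = a" "x (q + 1) = b" by blast
    have "3 * q + 2 + 1 = 3 * (q + 1)" by simp
    with q x_triple(1)[of "q + 1"] x_triple(3)[of q] show ?thesis by metis
  qed
  have "\<exists>q. x q = a \<and> x (q + 1) = next_letter a" if "a \<in> L" for a
    using letter_occurs[OF that] x_triple(1,2) by metis
  from this[of 0] this[of l] this[of m]
  have succ: "\<exists>q. x q = 0 \<and> x (q + 1) = l" "\<exists>q. x q = l \<and> x (q + 1) = m"
    "\<exists>q. x q = m \<and> x (q + 1) = 0"
    by auto
  have pred: "\<exists>q. x q = m \<and> x (q + 1) = l" "\<exists>q. x q = 0 \<and> x (q + 1) = m"
    "\<exists>q. x q = l \<and> x (q + 1) = 0"
    using succ[THEN step] by auto
  have "\<exists>q. x q = l \<and> x (q + 1) = l" "\<exists>q. x q = m \<and> x (q + 1) = m"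
    "\<exists>q. x q = 0 \<and> x (q + 1) = 0"
    using pred[THEN step] by auto
  with succ pred assms show ?thesis by (elim insertE emptyE) (simp_all only:)
qed

lemma pairs_at_distance:
  assumes "a \<in> L" "b \<in> L" "0 < k"
  shows "\<exists>q. x q = a \<and> x (q + k) = b"
  using assms
proof (induction k arbitrary: a b rule: less_induct)
  case (less k)
  \<comment> \<open>\<open>next_letter\<close> permutes \<open>L\<close>, so a letter prescribed
    inside an image can be pulled back to the letter generating that image.\<close>
  have next_surj: "\<exists>b'\<in>L. next_letter b' = b" "\<exists>b'\<in>L. next_letter (next_letter b') = b"
    "\<exists>a'\<in>L. next_letter a' = a"
    using less.prems by auto
  consider j where "k = 3 * j" "0 < j" | "k = 1" | "k = 2"
    | j where "k = 3 * j + 1" "0 < j" | j where "k = 3 * j + 2" "0 < j"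
  proof -
    have "k = 3 * (k div 3) \<or> k = 3 * (k div 3) + 1 \<or> k = 3 * (k div 3) + 2" by presburger
    with that \<open>0 < k\<close> show thesis by (cases "k div 3 = 0") auto
  qed
  then show ?case
  proof cases
    case (1 j)
    with less.prems less.IH[of j a b] obtain q where "x q = a" "x (q + j) = b" by auto
    moreover have "3 * q + k = 3 * (q + j)" using 1 by simp
    ultimately have "x (3 * q) = a \<and> x (3 * q + k) = b" by (simp only: x_triple)
    then show ?thesis ..
  next
    case 2
    with less.prems pairs_at_distance_1 show ?thesis by blast
  next
    case 3
    \<comment> \<open>The middle letter of one image and the first letter of the next are two
      positions apart.\<close>
    obtain a' where a': "a' \<in> L" "next_letter a' = a" using next_surj by blast
    with less.prems pairs_at_distance_1 obtain q where "x q = a'" "x (q + 1) = b" by blast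
    moreover have "3 * q + 1 + k = 3 * (q + 1)" using 3 by simp
    ultimately have "x (3 * q + 1) = a \<and> x (3 * q + 1 + k) = b" using a' by (simp only: x_triple)
    then show ?thesis ..
  next
    case (4 j)
    obtain b' where b': "b' \<in> L" "next_letter b' = b" using next_surj by blast
    with 4 less.prems less.IH[of j a b'] obtain q where "x q = a" "x (q + j) = b'" by auto
    moreover have "3 * q + k = 3 * (q + j) + 1" using 4 by simp
    ultimately have "x (3 * q) = a \<and> x (3 * q + k) = b" using b' by (simp only: x_triple)
    then show ?thesis ..
  next
    case (5 j)
    obtain b' where b': "b' \<in> L" "next_letter (next_letter b') = b" using next_surj by blast
    with 5 less.prems less.IH[of j a b'] obtain q where "x q = a" "x (q + j) = b'" by auto
    moreover have "3 * q + k = 3 * (q + j) + 2" using 5 by simp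
    ultimately have "x (3 * q) = a \<and> x (3 * q + k) = b" using b' by (simp only: x_triple)
    then show ?thesis ..
  qed
qed

lemma range_x: "range x = L"
proof
  show "range x \<subseteq> L" using x_in_L by (rule image_subsetI)
  show "L \<subseteq> range x"
  proof
    fix a assume "a \<in> L"
    then show "a \<in> range x" by (rule letter_occurs) (rule range_eqI, rule sym)
  qed
qed

lemma range_pair: "0 < k \<Longrightarrow> range (\<lambda>q. (x q, x (q + k))) = L \<times> L"
proof
  assume "0 < k"
  show "L \<times> L \<subseteq> range (\<lambda>q. (x q, x (q + k)))"
  proof (rule subrelI)
    fix a b assume "(a, b) \<in> L \<times> L"
    then obtain q where "x q = a" "x (q + k) = b"
      using pairs_at_distance[OF _ _ \<open>0 < k\<close>] by blast
    then show "(a, b) \<in> range (\<lambda>q. (x q, x (q + k)))"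
      by (intro range_eqI[of _ _ q]) simp
  qed
  show "range (\<lambda>q. (x q, x (q + k))) \<subseteq> L \<times> L"
    using x_in_L by blast
qed

section \<open>Parikh vectors of whole images and of partial ends\<close>

lemma parikh_append [simp]: "parikh (u @ v) = parikh u + parikh v"
  by (simp add: parikh_def)

lemma parikh_Nil [simp]: "parikh [] = 0"
  by (simp add: parikh_def zero_prod_def)

lemma parikh_blocks: "parikh (factor_at x (3 * q) (3 * k)) = (int k, int k, int k)"
proof (induction k)
  case 0
  then show ?case by (simp add: zero_prod_def)
next
  case (Suc k)
  have "factor_at x (3 * (q + k)) (1 + 1 + 1) =
      [x (3 * (q + k)), x (3 * (q + k) + 1), x (3 * (q + k) + 2)]"
    by (simp add: factor_at_def)
  then have "parikh (factor_at x (3 * q + 3 * k) 3) = (1, 1, 1)"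
    using x_in_L[of "q + k"] unfolding x_triple
    by (auto simp: parikh_def algebra_simps numeral_3_eq_3)
  with Suc show ?case
    using factor_at_add[of x "3 * q" "3 * k" 3] by (simp add: algebra_simps)
qed

lemma parikh_offset_0:
  "parikh (factor_at x (3 * q) (3 * k + s)) =
     (int k, int k, int k) + parikh (factor_at x (3 * (q + k)) s)"
  by (simp only: factor_at_add parikh_append parikh_blocks add_mult_distrib2)

text \<open>One letter into an image, two of its letters remain; then come \<open>k\<close> whole
  images and \<open>s\<close> letters from the start of the image of \<open>x (q + (k + 1))\<close>.
  The length is written to expose this cut.\<close>

lemma parikh_offset_1:
  "parikh (factor_at x (3 * q + 1) (2 + (3 * k + s))) =
     (int k, int k, int k) + (parikh (factor_at x (3 * q + 1) 2)
       + parikh (factor_at x (3 * (q + (k + 1))) s))"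
proof -
  have "3 * q + 1 + 2 = 3 * (q + 1)" by simp
  then show ?thesis
    unfolding factor_at_add[of x "3 * q + 1" 2] parikh_append
    by (simp only: parikh_offset_0) (simp add: algebra_simps)
qed

lemma parikh_offset_2:
  "parikh (factor_at x (3 * q + 2) (1 + (3 * k + s))) =
     (int k, int k, int k) + (parikh (factor_at x (3 * q + 2) 1)
       + parikh (factor_at x (3 * (q + (k + 1))) s))"
proof -
  have "3 * q + 2 + 1 = 3 * (q + 1)" by simp
  then show ?thesis
    unfolding factor_at_add[of x "3 * q + 2" 1] parikh_append
    by (simp only: parikh_offset_0) (simp add: algebra_simps)
qed

text \<open>A partial end depends only on the letter from whose image it is cut.\<close>

lemma parikh_short:
  "parikh (factor_at x (3 * q) 1) = parikh [x q]"
  "parikh (factor_at x (3 * q) 2) = parikh [x q, next_letter (x q)]"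
  "parikh (factor_at x (3 * q + 1) 2) = parikh [next_letter (x q), next_letter (next_letter (x q))]"
  "parikh (factor_at x (3 * q + 2) 1) = parikh [next_letter (next_letter (x q))]"
  using x_triple[of q] by (simp_all add: factor_at_1 factor_at_2)

lemma range_letter_image: "range (\<lambda>q. f (x q)) = {f 0, f l, f m}"
proof -
  have "range (\<lambda>q. f (x q)) = f ` range x"
    by (rule image_image[symmetric])
  then show ?thesis by (simp only: range_x image_insert image_empty)
qed

lemma range_shifted_letter_image: "range (\<lambda>q. f (x (q + k))) = {f 0, f l, f m}"
\<comment> \<open>\<open>range_pair\<close> needs a positive distance, but distance 0 occurs: a
  factor of length 2 that begins an image has no whole image before its end piece.\<close>
proof (cases "k = 0")
  case True
  then show ?thesis using range_letter_image[of f] by simp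
next
  case False
  have "range (\<lambda>q. f (x (q + k))) = (\<lambda>(a, b). f b) ` range (\<lambda>q. (x q, x (q + k)))"
    unfolding image_image by simp
  also have "\<dots> = {f 0, f l, f m}" using range_pair[of k] False by force
  finally show ?thesis .
qed

lemma range_pair_image:
  assumes "0 < k"
  shows "range (\<lambda>q. f (x q) (x (q + k))) =
    {f 0 0, f 0 l, f 0 m, f l 0, f l l, f l m, f m 0, f m l, f m m}"
proof -
  have "range (\<lambda>q. f (x q) (x (q + k))) = (\<lambda>(a, b). f a b) ` range (\<lambda>q. (x q, x (q + k)))"
    unfolding image_image by simp
  also have "\<dots> = (\<Union>a\<in>L. f a ` L)"
    unfolding range_pair[OF assms] by (rule image_case_prod_Times)
  also have "\<dots> = {f 0 0, f 0 l, f 0 m, f l 0, f l l, f l m, f m 0, f m l, f m m}"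
    by (simp only: image_insert image_empty Union_insert Union_empty Un_insert_left Un_empty_left
        Un_empty_right)
  finally show ?thesis .
qed

lemma parikh_factors_0: "parikh ` factors x 0 = {0}"
  by (auto simp: factors_def)

lemma parikh_factors_1: "parikh ` factors x 1 = {(1, 0, 0), (0, 1, 0), (0, 0, 1)}"
proof -
  have "factors x 1 = (\<lambda>a. [a]) ` range x"
    by (auto simp: factors_def factor_at_1)
  then show ?thesis by (auto simp: range_x parikh_def)
qed

section \<open>Parikh vectors for each residue of the length\<close>

text \<open>\<open>S0\<close>, \<open>S1\<close> and \<open>S2\<close> consist of all vectors with
  entries in {0, 1, 2} and entry sum 3, 4 and 2; they belong to the factors of these
  lengths.\<close>

definition S0 :: "(int \<times> int \<times> int) set" where
  "S0 = {(1, 1, 1), (2, 0, 1), (2, 1, 0), (0, 2, 1), (1, 2, 0), (0, 1, 2), (1, 0, 2)}"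

definition S1 :: "(int \<times> int \<times> int) set" where
  "S1 = {(2, 1, 1), (1, 2, 1), (1, 1, 2), (2, 2, 0), (2, 0, 2), (0, 2, 2)}"

definition S2 :: "(int \<times> int \<times> int) set" where
  "S2 = {(1, 1, 0), (1, 0, 1), (0, 1, 1), (2, 0, 0), (0, 2, 0), (0, 0, 2)}"

text \<open>At offsets 1 and 2 the two ends together form a full triple with one letter exchanged
  for another or kept. The outer images are \<open>k + 1\<close> apart, so every exchange
  occurs.\<close>

lemma parikh_factors_3k:
  "parikh ` factors x (3 * k + 3) = (+) (int k, int k, int k) ` S0"
proof -
  have k: "0 < k + 1" by simp
  let ?c = "(int k, int k, int k)"
  let ?f = "\<lambda>a b. parikh [next_letter a, next_letter (next_letter a), b]"
  let ?g = "\<lambda>a b. parikh [next_letter (next_letter a), b, next_letter b]"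
  have 0: "parikh (factor_at x (3 * q) (3 * k + 3)) = ?c + (1, 1, 1)" for q
    using parikh_offset_0[of q "k + 1" 0] by (simp add: algebra_simps)
  have 1: "parikh (factor_at x (3 * q + 1) (3 * k + 3)) = ?c + ?f (x q) (x (q + (k + 1)))" for q
    using parikh_offset_1[of q k 1] parikh_append[of "[_, _]" "[_]"] unfolding parikh_short
    by (simp add: eval_nat_numeral)
  have 2: "parikh (factor_at x (3 * q + 2) (3 * k + 3)) = ?c + ?g (x q) (x (q + (k + 1)))" for q
    using parikh_offset_2[of q k 2] parikh_append[of "[_]" "[_, _]"] unfolding parikh_short
    by (simp add: eval_nat_numeral)
  have "parikh ` factors x (3 * k + 3) = (+) ?c ` ({(1, 1, 1)}
      \<union> range (\<lambda>q. ?f (x q) (x (q + (k + 1)))) \<union> range (\<lambda>q. ?g (x q) (x (q + (k + 1)))))"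
    unfolding factors_mod_3 image_Un image_image 0 1 2 by simp
  also have "{(1, 1, 1)} \<union> range (\<lambda>q. ?f (x q) (x (q + (k + 1))))
      \<union> range (\<lambda>q. ?g (x q) (x (q + (k + 1)))) = S0"
    unfolding range_pair_image[of "k + 1" ?f, OF k]
      range_pair_image[of "k + 1" ?g, OF k]
    by (intro equalityI) (simp_all add: S0_def parikh_def)
  finally show ?thesis .
qed

text \<open>Offsets 0 and 2 give \<open>k + 1\<close> whole images and one letter; offset 1 has two
  letters at each end, that is, two triples each missing one letter.\<close>

lemma parikh_factors_3k1:
  "parikh ` factors x (3 * k + 4) = (+) (int k, int k, int k) ` S1"
proof -
  have k: "0 < k + 1" by simp
  let ?c = "(int k, int k, int k)"
  \<comment> \<open>The additional whole image at offsets 0 and 2 is split off, so that all offsets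
    share the translation \<open>?c\<close>.\<close>
  have c: "(int (k + 1), int (k + 1), int (k + 1)) = ?c + (1, 1, 1)"
    by simp
  have n: "3 * (k + 1) + 1 = 3 * k + 4" "1 + (3 * (k + 1) + 0) = 3 * k + 4"
    by simp_all
  let ?f = "\<lambda>a b. parikh [next_letter a, next_letter (next_letter a), b, next_letter b]"
  let ?g = "\<lambda>a. (1, 1, 1) + parikh [a]"
  let ?h = "\<lambda>a. (1, 1, 1) + parikh [next_letter (next_letter a)]"
  have 0: "parikh (factor_at x (3 * q) (3 * k + 4)) = ?c + ?g (x (q + (k + 1)))" for q
    using parikh_offset_0[of q "k + 1" 1] unfolding n parikh_short c add.assoc[of ?c] .
  have 1: "parikh (factor_at x (3 * q + 1) (3 * k + 4)) = ?c + ?f (x q) (x (q + (k + 1)))" for q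
    using parikh_offset_1[of q k 2] parikh_append[of "[_, _]" "[_, _]"] unfolding parikh_short
    by (simp add: eval_nat_numeral)
  have 2: "parikh (factor_at x (3 * q + 2) (3 * k + 4)) = ?c + ?h (x q)" for q
    using parikh_offset_2[of q "k + 1" 0] unfolding n parikh_short c add.assoc[of ?c] by simp
  have "parikh ` factors x (3 * k + 4) = (+) ?c ` (range (\<lambda>q. ?g (x (q + (k + 1))))
      \<union> range (\<lambda>q. ?f (x q) (x (q + (k + 1)))) \<union> range (\<lambda>q. ?h (x q)))"
    unfolding factors_mod_3 image_Un image_image 0 1 2 by simp
  also have "range (\<lambda>q. ?g (x (q + (k + 1)))) \<union> range (\<lambda>q. ?f (x q) (x (q + (k + 1))))
      \<union> range (\<lambda>q. ?h (x q)) = S1"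
    unfolding range_pair_image[of "k + 1" ?f, OF k] range_letter_image[of ?h]
      range_shifted_letter_image[of ?g]
    by (intro equalityI) (simp_all add: S1_def parikh_def)
  finally show ?thesis .
qed

text \<open>Offset 2 leaves one letter at each end, hence also doubled letters; the other offsets
  leave two distinct letters of one image.\<close>

lemma parikh_factors_3k2:
  "parikh ` factors x (3 * k + 2) = (+) (int k, int k, int k) ` S2"
proof -
  have k: "0 < k + 1" by simp
  let ?c = "(int k, int k, int k)"
  let ?f = "\<lambda>a b. parikh [next_letter (next_letter a), b]"
  let ?g = "\<lambda>a. parikh [a, next_letter a]"
  let ?h = "\<lambda>a. parikh [next_letter a, next_letter (next_letter a)]"
  have 0: "parikh (factor_at x (3 * q) (3 * k + 2)) = ?c + ?g (x (q + k))" for q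
    using parikh_offset_0[of q k 2] unfolding parikh_short .
  have 1: "parikh (factor_at x (3 * q + 1) (3 * k + 2)) = ?c + ?h (x q)" for q
    using parikh_offset_1[of q k 0] unfolding parikh_short by (simp add: add.commute)
  have 2: "parikh (factor_at x (3 * q + 2) (3 * k + 2)) = ?c + ?f (x q) (x (q + (k + 1)))" for q
    using parikh_offset_2[of q k 1] parikh_append[of "[_]" "[_]"] unfolding parikh_short
    by (simp add: eval_nat_numeral)
  have "parikh ` factors x (3 * k + 2) = (+) ?c ` (range (\<lambda>q. ?g (x (q + k)))
      \<union> range (\<lambda>q. ?h (x q)) \<union> range (\<lambda>q. ?f (x q) (x (q + (k + 1)))))"
    unfolding factors_mod_3 image_Un image_image 0 1 2 by simp
  also have "range (\<lambda>q. ?g (x (q + k))) \<union> range (\<lambda>q. ?h (x q))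
      \<union> range (\<lambda>q. ?f (x q) (x (q + (k + 1)))) = S2"
    unfolding range_pair_image[of "k + 1" ?f, OF k] range_letter_image[of ?h]
      range_shifted_letter_image[of ?g]
    by (intro equalityI) (simp_all add: S2_def parikh_def)
  finally show ?thesis .
qed

text \<open>The translation \<open>c\<close> stays unspecified, since cardinalities ignore it.
  Lengths 0 and 1 stand apart because the descriptions by \<open>S0\<close> and \<open>S1\<close>
  begin at lengths 3 and 4.\<close>

lemma parikh_factors_cases:
  obtains "n = 0" | "n = 1"
  | c where "n \<noteq> 0" "n mod 3 = 0" "parikh ` factors x n = (+) c ` S0"
  | c where "n \<noteq> 1" "n mod 3 = 1" "parikh ` factors x n = (+) c ` S1"
  | c where "n mod 3 = 2" "parikh ` factors x n = (+) c ` S2"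
proof -
  consider "n = 0" | "n = 1" | k where "n = 3 * k + 3" | k where "n = 3 * k + 4"
    | k where "n = 3 * k + 2"
  proof -
    \<comment> \<open>Truncated subtraction does no harm: the lengths 0, 1 and 2 fall under the
      other disjuncts.\<close>
    have "n = 0 \<or> n = 1 \<or> n = 3 * (n div 3 - 1) + 3 \<or> n = 3 * (n div 3 - 1) + 4
        \<or> n = 3 * (n div 3) + 2"
      by presburger
    with that show thesis by blast
  qed
  then show thesis
  proof cases
    case (3 k)
    then have "n \<noteq> 0" "n mod 3 = 0" by presburger+
    then show thesis by (rule that(3)) (simp only: 3 parikh_factors_3k)
  next
    case (4 k)
    then have "n \<noteq> 1" "n mod 3 = 1" by presburger+
    then show thesis by (rule that(4)) (simp only: 4 parikh_factors_3k1)
  next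
    case (5 k)
    then have "n mod 3 = 2" by presburger
    then show thesis by (rule that(5)) (simp only: 5 parikh_factors_3k2)
  qed (use that in blast)+
qed

section \<open>From equivalence classes to vectors and weights\<close>

lemma abelian_complexity_eq_card: "abelian_complexity x n = card (parikh ` factors x n)"
proof -
  have "abelian_equivalent u v \<longleftrightarrow> parikh u = parikh v" if "u \<in> factors x n" "v \<in> factors x n" for u v
  proof -
    have "set u \<subseteq> L" "set v \<subseteq> L"
      using that set_factor_at_subset[of x] range_x by (auto simp: factors_def)
    \<comment> \<open>Letters outside \<open>L\<close> occur in neither word, so three counts decide
      abelian equivalence.\<close>
    then have "count_list u a = count_list v a" if "a \<notin> L" for a
      using that by (metis count_notin subsetD)
    then have "abelian_equivalent u v \<longleftrightarrow> (\<forall>a\<in>L. count_list u a = count_list v a)"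
      unfolding abelian_equivalent_def by blast
    then show ?thesis by (simp add: parikh_def)
  qed
  then have "{(u, v) \<in> factors x n \<times> factors x n. abelian_equivalent u v} =
      {(u, v) \<in> factors x n \<times> factors x n. parikh u = parikh v}"
    by blast
  then show ?thesis
    by (simp only: abelian_complexity_def card_quotient_kernel)
qed

lemma additive_complexity_eq_card:
  "additive_complexity l m x n = card (weight ` parikh ` factors x n)"
proof -
  have "additively_equivalent l m u v \<longleftrightarrow> weight (parikh u) = weight (parikh v)"
    if "u \<in> factors x n" "v \<in> factors x n" for u v
  proof -
    have "length u = length v" using that by (auto simp: factors_def)
    then show ?thesis by (simp add: additively_equivalent_def parikh_def weight_def)
  qed
  then have "{(u, v) \<in> factors x n \<times> factors x n. additively_equivalent l m u v} =
      {(u, v) \<in> factors x n \<times> factors x n. weight (parikh u) = weight (parikh v)}"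
    by blast
  then show ?thesis
    by (simp only: additive_complexity_def card_quotient_kernel image_image)
qed

section \<open>Cardinalities of the sets and of their weights\<close>

lemma weight_add: "weight (u + v) = weight u + weight v"
  by (simp add: weight_def split_beta algebra_simps)

lemma card_translate: "card ((+) c ` S) = card S" for c :: "'a::cancel_semigroup_add"
  by (rule card_image) (simp add: inj_on_def)

lemma card_weight_translate: "card (weight ` (+) c ` S) = card (weight ` S)"
proof -
  have "weight ` (+) c ` S = (+) (weight c) ` weight ` S"
    by (simp add: image_image weight_add)
  then show ?thesis by (simp only: card_translate)
qed

lemma card_S: "card S0 = 7" "card S1 = 6" "card S2 = 6"
  by (simp_all add: S0_def S1_def S2_def)

text \<open>Given \<open>0 < l\<close> and \<open>l < m\<close>, two weights within one set can
  coincide only as \<open>m = 2 * l\<close> or \<open>2 * l + m = 2 * m\<close>, which are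
  equivalent.\<close>

lemma card_weight_generic:
  assumes "m \<noteq> 2 * l"
  shows "card (weight ` S0) = 7" "card (weight ` S1) = 6" "card (weight ` S2) = 6"
  using assms l_pos l_less_m
  by (simp_all add: S0_def S1_def S2_def weight_def card_insert_if)

text \<open>Divided by \<open>l\<close>, the weights fill five consecutive integers: 1 to 5, 2 to 6
  and 0 to 4, respectively.\<close>

lemma card_weight_2:
  assumes "m = 2 * l"
  shows "card (weight ` S0) = 5" "card (weight ` S1) = 5" "card (weight ` S2) = 5"
proof -
  let ?v = "\<lambda>(_, b, c). b + 2 * c :: int"
  have "weight u = ?v u * l" for u :: "int \<times> int \<times> int"
    unfolding weight_def by (simp add: assms split_beta algebra_simps)
  then have "weight ` S = (\<lambda>j. j * l) ` ?v ` S" for S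
    by (simp add: image_image)
  moreover have "inj (\<lambda>j. j * l)"
    by (simp add: inj_on_def)
  ultimately have card: "card (weight ` S) = card (?v ` S)" for S
    using card_image[OF inj_on_subset[OF _ subset_UNIV]] by (simp only:)
  show "card (weight ` S0) = 5" "card (weight ` S1) = 5" "card (weight ` S2) = 5"
    unfolding card by (simp_all add: S0_def S1_def S2_def card_insert_if)
qed

section \<open>Values of the two complexities\<close>

lemma complexity_0: "abelian_complexity x 0 = 1" "additive_complexity l m x 0 = 1"
  by (simp_all add: abelian_complexity_eq_card additive_complexity_eq_card parikh_factors_0)

lemma complexity_1: "abelian_complexity x 1 = 3" "additive_complexity l m x 1 = 3"
  unfolding abelian_complexity_eq_card additive_complexity_eq_card parikh_factors_1
  by (simp_all add: weight_def)

lemma abelian_complexity_tm_word: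
  "abelian_complexity x n =
     (if n = 0 then 1 else if n = 1 then 3 else if n mod 3 = 0 then 7 else 6)"
  by (rule parikh_factors_cases[of n])
    (auto simp: complexity_0 complexity_1[unfolded One_nat_def]
      abelian_complexity_eq_card[of n] card_translate card_S)

lemma additive_complexity_generic:
  assumes "m \<noteq> 2 * l"
  shows "additive_complexity l m x n = abelian_complexity x n"
  by (rule parikh_factors_cases[of n])
    (auto simp: complexity_0 complexity_1[unfolded One_nat_def]
      abelian_complexity_eq_card[of n] additive_complexity_eq_card[of n]
      card_translate card_weight_translate card_S card_weight_generic[OF assms])

lemma additive_complexity_2:
  assumes "m = 2 * l"
  shows "additive_complexity l m x n = (if n = 0 then 1 else if n = 1 then 3 else 5)"
  by (rule parikh_factors_cases[of n])
    (auto simp: complexity_0 complexity_1[unfolded One_nat_def]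
      additive_complexity_eq_card[of n] card_weight_translate card_weight_2[OF assms])

end

theorem theorem4p5:
  fixes l m :: int
  assumes "1 \<le> l" and "l < m"
  shows "(\<forall>n. abelian_complexity (tm_word l m) n =
            (if n = 0 then 1 else if n = 1 then 3 else if n mod 3 = 0 then 7 else 6))
       \<and> (m \<noteq> 2 * l \<longrightarrow>
            additive_complexity l m (tm_word l m) = abelian_complexity (tm_word l m))
       \<and> (m = 2 * l \<longrightarrow>
            (\<forall>n. additive_complexity l m (tm_word l m) n =
               (if n = 0 then 1 else if n = 1 then 3 else 5)))"
proof -
  interpret tm_alphabet l m
    using assms by unfold_locales auto
  show ?thesis
    using abelian_complexity_tm_word additive_complexity_generic additive_complexity_2 by blast
qed

end
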